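(* Let $f,g,c$ satisfy the standing assumption on the composite problem (P), $\min_x\Phi(x)=f(x)+g(c(x))$, and suppose that (P) possesses a stationary minimizer. Let $\{(x^k,z^k,y^k,\hat y^k)\}$ be a sequence generated by the safeguarded augmented Lagrangian method (described in the context) such that $\sum_{k=0}^\infty\sqrt{\varepsilon_k/\mu_k}<\infty$. Assume that the penalty parameter is updated as follows: there are $\beta,\theta\in(0,1)$ such that, for each $k\in\mathbb N_0$, $\mu_{k+1}=\mu_k$ if $k=0$ or $\|c(x^k)-z^k\|\le\theta\|c(x^{k-1})-z^{k-1}\|$, and $\mu_{k+1}=\beta\mu_k$ otherwise. Then $c(x^k)-z^k\to0$ and $$\limsup_{k\to\infty}\left(f(x^k)+g(z^k)\right)\le\Phi^\star .$$ Particularly, each accumulation point $\bar x\in\mathbb R^n$ of $\{x^k\}$ is a minimizer of (P). For each subsequence $\{x^k\}_{k\in K}$ ($K\subseteq\mathbb N$ infinite) converging to some $\bar x$, one has $z^k\to c(\bar x)$ and $f(x^k)+g(z^k)\to\Phi^\star$ as $k\to\infty$, $k\in K$.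
   Context: Spaces $\mathbb R^n,\mathbb R^m$ carry the Euclidean inner product $\langle\cdot,\cdot\rangle$ and norm $\|\cdot\|$; $\overline{\mathbb R}=\mathbb R\cup\{+\infty\}$. For a proper lsc convex $g:\mathbb R^m\to\overline{\mathbb R}$, the horizon is $\operatorname{hzn} g=\{v\in\mathbb R^m : g(z+v)\le g(z)\ \forall z\in\operatorname{dom} g\}$. Standing assumption: $f:\mathbb R^n\to\mathbb R$ is continuously differentiable and convex; $g:\mathbb R^m\to\overline{\mathbb R}$ is proper, lsc, convex; $c:\mathbb R^n\to\mathbb R^m$ is continuously differentiable and $(-\operatorname{hzn} g)$-convex, i.e. $c(\lambda x+(1-\lambda)x')-\lambda c(x)-(1-\lambda)c(x')\in\operatorname{hzn} g$ for all $x,x'\in\mathbb R^n$, $\lambda\in[0,1]$; (P) is feasible and possesses a minimizer, with minimal value $\Phi^\star$. A feasible point $\bar x$ is stationary if there is $\bar y\in\partial g(c(\bar x))$ with $\nabla f(\bar x)+c'(\bar x)^\top\bar y=0$. Augmented Lagrangian for $\mu>0$: $L_\mu(x,y)=f(x)+g^\mu(c(x)+\mu y)-\frac\mu2\|y\|^2$, where $g^\mu(z)=\inf_w\{g(w)+\frac1{2\mu}\|w-z\|^2\}$. $\operatorname{prox}_\varphi(z)$ is the unique minimizer of $w\mapsto\varphi(w)+\frac12\|w-z\|^2$; $\operatorname{proj}_S$ is the Euclidean projection onto $S$. Safeguarded ALM. Data: $y^0\in\mathbb R^m$; $\mu_0>0$; nonempty, convex, compact set $S\subseteq\mathbb R^m$.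 For $k=0,1,2,\dots$: set $\hat y^k=\operatorname{proj}_S(y^k)$; select $\varepsilon_k\ge0$ and $x^k\in\mathbb R^n$ with $L_{\mu_k}(x^k,\hat y^k)\le\inf_xL_{\mu_k}(x,\hat y^k)+\varepsilon_k$; set $z^k=\operatorname{prox}_{\mu_kg}(c(x^k)+\mu_k\hat y^k)$; set $y^{k+1}=\hat y^k+\mu_k^{-1}(c(x^k)-z^k)$; update $\mu_{k+1}$ from $\mu_k$ by the rule given in the claim. *)

theory Defs
  imports "HOL-Analysis.Analysis"
begin

text \<open>Functions with values in \<open>\<real> \<union> {+\<infinity>}\<close> are \<^typ>\<open>ereal\<close>-valued functions; the value
  \<open>-\<infinity>\<close> is excluded by \<open>proper_fun\<close>.\<close>

definition edom :: "('a \<Rightarrow> ereal) \<Rightarrow> 'a set"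
  where "edom g = {z. g z < \<infinity>}"

definition proper_fun :: "('a \<Rightarrow> ereal) \<Rightarrow> bool"
  where "proper_fun g \<longleftrightarrow> (\<forall>z. g z \<noteq> -\<infinity>) \<and> edom g \<noteq> {}"

definition lsc_fun :: "('a::topological_space \<Rightarrow> ereal) \<Rightarrow> bool"
  where "lsc_fun g \<longleftrightarrow> (\<forall>z. g z \<le> Liminf (at z) g)"

definition econvex_fun :: "('a::real_vector \<Rightarrow> ereal) \<Rightarrow> bool"
  where "econvex_fun g \<longleftrightarrow>
    (\<forall>z w. \<forall>t\<in>{0<..<1}. g (t *\<^sub>R z + (1 - t) *\<^sub>R w) \<le> ereal t * g z + ereal (1 - t) * g w)"

definition hzn :: "('a::real_vector \<Rightarrow> ereal) \<Rightarrow> 'a set"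
  where "hzn g = {v. \<forall>z\<in>edom g. g (z + v) \<le> g z}"

definition subdifferential :: "('a::real_inner \<Rightarrow> ereal) \<Rightarrow> 'a \<Rightarrow> 'a set"
  where "subdifferential g z =
    {v. z \<in> edom g \<and> (\<forall>w. g z + ereal (v \<bullet> (w - z)) \<le> g w)}"

definition is_minimizer :: "('a \<Rightarrow> ereal) \<Rightarrow> 'a \<Rightarrow> bool"
  where "is_minimizer h x \<longleftrightarrow> is_arg_min h (\<lambda>_. True) x"

definition moreau_env :: "real \<Rightarrow> ('a::real_normed_vector \<Rightarrow> ereal) \<Rightarrow> 'a \<Rightarrow> ereal"
  where "moreau_env \<mu> g z = (INF w. g w + ereal (1 / (2 * \<mu>) * (norm (w - z))\<^sup>2))"

definition prox :: "('a::real_normed_vector \<Rightarrow> ereal) \<Rightarrow> 'a \<Rightarrow> 'a"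
  where "prox h z = (THE w. is_minimizer (\<lambda>w. h w + ereal (1 / 2 * (norm (w - z))\<^sup>2)) w)"

text \<open>Continuity of the derivative is with respect to the operator norm.\<close>
definition C1_fun :: "('a::real_normed_vector \<Rightarrow> 'b::real_normed_vector) \<Rightarrow> bool"
  where "C1_fun F \<longleftrightarrow> (\<exists>F' :: 'a \<Rightarrow> 'a \<Rightarrow>\<^sub>L 'b.
    (\<forall>x. (F has_derivative blinfun_apply (F' x)) (at x)) \<and> continuous_on UNIV F')"

definition gradient :: "('a::real_inner \<Rightarrow> real) \<Rightarrow> 'a \<Rightarrow> 'a"
  where "gradient f x = (THE d. GDERIV f x :> d)"

definition objective :: "('a \<Rightarrow> real) \<Rightarrow> ('b \<Rightarrow> ereal) \<Rightarrow> ('a \<Rightarrow> 'b) \<Rightarrow> 'a \<Rightarrow> ereal"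
  where "objective f g c x = ereal (f x) + g (c x)"

definition min_value :: "('a \<Rightarrow> real) \<Rightarrow> ('b \<Rightarrow> ereal) \<Rightarrow> ('a \<Rightarrow> 'b) \<Rightarrow> ereal"
  where "min_value f g c = (INF x. objective f g c x)"

definition feasible :: "('b \<Rightarrow> ereal) \<Rightarrow> ('a \<Rightarrow> 'b) \<Rightarrow> 'a \<Rightarrow> bool"
  where "feasible g c x \<longleftrightarrow> c x \<in> edom g"

text \<open>\<open>c\<close> is \<open>K\<close>-convex for \<open>K = -hzn g\<close> if \<open>t c(x) + (1 - t) c(x') - c(t x + (1 - t) x') \<in> K\<close>;
  the minus sign of \<open>K\<close> is moved to the left.\<close>
definition neg_hzn_convex :: "('b::real_vector \<Rightarrow> ereal) \<Rightarrow> ('a::real_vector \<Rightarrow> 'b) \<Rightarrow> bool"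
  where "neg_hzn_convex g c \<longleftrightarrow> (\<forall>x x'. \<forall>t\<in>{0..1}.
    c (t *\<^sub>R x + (1 - t) *\<^sub>R x') - t *\<^sub>R c x - (1 - t) *\<^sub>R c x' \<in> hzn g)"

definition standing_assumption ::
  "(real^'n \<Rightarrow> real) \<Rightarrow> (real^'m \<Rightarrow> ereal) \<Rightarrow> (real^'n \<Rightarrow> real^'m) \<Rightarrow> bool"
  where "standing_assumption f g c \<longleftrightarrow>
    C1_fun f \<and> convex_on UNIV f \<and>
    proper_fun g \<and> lsc_fun g \<and> econvex_fun g \<and>
    C1_fun c \<and> neg_hzn_convex g c \<and>
    (\<exists>x. feasible g c x) \<and> (\<exists>x. is_minimizer (objective f g c) x)"

definition stationary ::
  "(real^'n \<Rightarrow> real) \<Rightarrow> (real^'m \<Rightarrow> ereal) \<Rightarrow> (real^'n \<Rightarrow> real^'m) \<Rightarrow> real^'n \<Rightarrow> bool"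
  where "stationary f g c x \<longleftrightarrow> feasible g c x \<and>
    (\<exists>v\<in>subdifferential g (c x). gradient f x + transpose (jacobian c (at x)) *v v = 0)"

definition aug_lagrangian ::
  "('a \<Rightarrow> real) \<Rightarrow> ('b::real_normed_vector \<Rightarrow> ereal) \<Rightarrow> ('a \<Rightarrow> 'b) \<Rightarrow> real \<Rightarrow> 'a \<Rightarrow> 'b \<Rightarrow> ereal"
  where "aug_lagrangian f g c \<mu> x y =
    ereal (f x) + moreau_env \<mu> g (c x + \<mu> *\<^sub>R y) - ereal (\<mu> / 2 * (norm y)\<^sup>2)"

text \<open>The update of the penalty parameters \<open>\<mu>\<close> is left open here; the initial data are
  \<open>\<mu> 0\<close> and the arbitrary \<open>y 0\<close>.\<close>
definition safeguarded_ALM ::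
  "(real^'n \<Rightarrow> real) \<Rightarrow> (real^'m \<Rightarrow> ereal) \<Rightarrow> (real^'n \<Rightarrow> real^'m) \<Rightarrow> (real^'m) set \<Rightarrow>
   (nat \<Rightarrow> real) \<Rightarrow> (nat \<Rightarrow> real) \<Rightarrow> (nat \<Rightarrow> real^'n) \<Rightarrow> (nat \<Rightarrow> real^'m) \<Rightarrow>
   (nat \<Rightarrow> real^'m) \<Rightarrow> (nat \<Rightarrow> real^'m) \<Rightarrow> bool"
  where "safeguarded_ALM f g c S \<mu> \<epsilon> x z y yhat \<longleftrightarrow>
    S \<noteq> {} \<and> convex S \<and> compact S \<and> 0 < \<mu> 0 \<and>
    (\<forall>k. yhat k = closest_point S (y k) \<and>
         0 \<le> \<epsilon> k \<and>
         aug_lagrangian f g c (\<mu> k) (x k) (yhat k)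
           \<le> (INF u. aug_lagrangian f g c (\<mu> k) u (yhat k)) + ereal (\<epsilon> k) \<and>
         z k = prox (\<lambda>w. ereal (\<mu> k) * g w) (c (x k) + \<mu> k *\<^sub>R yhat k) \<and>
         y (Suc k) = yhat k + inverse (\<mu> k) *\<^sub>R (c (x k) - z k))"

definition penalty_update ::
  "real \<Rightarrow> real \<Rightarrow> ('a \<Rightarrow> 'b::real_normed_vector) \<Rightarrow> (nat \<Rightarrow> 'a) \<Rightarrow> (nat \<Rightarrow> 'b) \<Rightarrow> (nat \<Rightarrow> real) \<Rightarrow> bool"
  where "penalty_update \<beta> \<theta> c x z \<mu> \<longleftrightarrow> (\<forall>k. \<mu> (Suc k) =
    (if k = 0 \<or> norm (c (x k) - z k) \<le> \<theta> * norm (c (x (k - 1)) - z (k - 1))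
     then \<mu> k else \<beta> * \<mu> k))"

definition seq_accumulation_point :: "(nat \<Rightarrow> 'a::topological_space) \<Rightarrow> 'a \<Rightarrow> bool"
  where "seq_accumulation_point x l \<longleftrightarrow>
    (\<exists>r :: nat \<Rightarrow> nat. strict_mono r \<and> (\<lambda>k. x (r k)) \<longlonglongrightarrow> l)"

end

theory Submission
  imports Defs
begin

text \<open>For a stationary minimizer with multiplier \<open>v\<close>, convexity gives
  \<open>f x + g w \<ge> \<Phi>\<^sup>\<star> - v \<bullet> (c x - w)\<close> for all \<open>x, w\<close>, because \<open>v\<close> is nonpositive on \<open>hzn g\<close> and
  hence \<open>f + v \<bullet> c\<close> is convex with a critical point at the minimizer. Conversely, evaluating the
  augmented Lagrangian at the minimizer yields, with \<open>s = c x - z\<close>,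
  \<open>f x + g z + yhat \<bullet> s + \<parallel>s\<parallel>\<^sup>2 / (2 \<mu>) \<le> \<Phi>\<^sup>\<star> + \<epsilon>\<close>. If \<open>\<mu> \<rightarrow> 0\<close>, combining both bounds gives
  \<open>\<parallel>s\<parallel>\<^sup>2 \<le> 2 \<mu> (\<epsilon> + C \<parallel>s\<parallel>)\<close>, so \<open>s \<rightarrow> 0\<close>; otherwise the penalty is eventually constant and the
  update rule forces linear decay of \<open>\<parallel>s\<parallel>\<close>. Since \<open>\<epsilon> \<rightarrow> 0\<close> and \<open>yhat\<close> is bounded, the
  two bounds squeeze \<open>f x + g z\<close> to \<open>\<Phi>\<^sup>\<star>\<close>.\<close>

section \<open>Proximal points of convex functions\<close>

text \<open>Passes from the punctured filter \<open>at l\<close> in \<open>lsc_fun\<close> to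
  sequences, which may take the value \<open>l\<close> itself.\<close>

lemma lsc_funD_liminf:
  assumes "lsc_fun g" and X: "X \<longlonglongrightarrow> l"
  shows "g l \<le> liminf (\<lambda>n. g (X n))"
  unfolding le_Liminf_iff
proof (intro allI impI)
  fix r assume r: "r < g l"
  have "g l \<le> Liminf (at l) g"
    using assms(1) by (simp add: lsc_fun_def)
  then have "\<forall>\<^sub>F w in at l. r < g w"
    using r by (simp add: le_Liminf_iff)
  \<comment> \<open>The strict inequality at \<open>l\<close> itself fills the hole of the punctured
    neighbourhood.\<close>
  then have "\<forall>\<^sub>F w in nhds l. r < g w"
    using r by (auto simp: eventually_at_filter elim: eventually_mono)
  then show "\<forall>\<^sub>F n in sequentially. r < g (X n)"
    using X by (rule eventually_compose_filterlim)
qed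

lemma lsc_fun_add_continuous_closed:
  fixes h :: "'a::metric_space \<Rightarrow> ereal"
  assumes "lsc_fun h" and q: "continuous_on UNIV q"
  shows "closed {w. h w + ereal (q w) \<le> r}"
  unfolding closed_sequential_limits
proof (intro allI impI, elim conjE)
  fix X l assume X: "\<forall>n. X n \<in> {w. h w + ereal (q w) \<le> r}" "X \<longlonglongrightarrow> l"
  have "(\<lambda>n. ereal (q (X n))) \<longlonglongrightarrow> ereal (q l)"
    using q X(2) by (auto intro: continuous_on_tendsto_compose)
  then have "liminf (\<lambda>n. ereal (q (X n)) + h (X n)) = ereal (q l) + liminf (\<lambda>n. h (X n))"
    by (intro ereal_liminf_lim_add) auto
  moreover have "h l \<le> liminf (\<lambda>n. h (X n))"
    using assms(1) X(2) by (rule lsc_funD_liminf)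
  ultimately have "ereal (q l) + h l \<le> liminf (\<lambda>n. ereal (q (X n)) + h (X n))"
    by (simp add: add_left_mono)
  also have "\<dots> \<le> r"
    using X(1) by (intro Liminf_le) (auto simp: add.commute)
  finally show "l \<in> {w. h w + ereal (q w) \<le> r}"
    by (simp add: add.commute)
qed

text \<open>A Weierstrass theorem by the finite intersection property: finitely many sublevel sets
  above the infimum intersect in the one of the smallest level, which meets
  \<open>K\<close>.\<close>

lemma compact_attains_inf_closed_sublevels:
  fixes F :: "'a::topological_space \<Rightarrow> ereal"
  assumes "compact K" "K \<noteq> {}" and closed: "\<And>r. closed {w. F w \<le> r}"
  shows "\<exists>w\<in>K. \<forall>u\<in>K. F w \<le> F u"
proof -
  define m where "m = (INF u\<in>K. F u)"
  have "K \<inter> (\<Inter>r\<in>{m<..}. {w. F w \<le> r}) \<noteq> {}"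
  proof (rule compact_imp_fip_image[OF \<open>compact K\<close> closed])
    fix I assume I: "finite I" "I \<subseteq> {m<..}"
    show "K \<inter> (\<Inter>r\<in>I. {w. F w \<le> r}) \<noteq> {}"
    proof (cases "I = {}")
      case False
      then have "m < Min I" using I by auto
      then obtain u where "u \<in> K" "F u < Min I"
        unfolding m_def by (auto simp: INF_less_iff)
      then have "u \<in> K \<inter> (\<Inter>r\<in>I. {w. F w \<le> r})"
        using I False by auto
      then show ?thesis by blast
    qed (use \<open>K \<noteq> {}\<close> in auto)
  qed
  then obtain w where w: "w \<in> K" "\<And>r. m < r \<Longrightarrow> F w \<le> r" by auto
  from w(2) have "F w \<le> m" by (rule dense_ge)
  then show ?thesis
    using w(1) unfolding m_def by (auto simp: le_INF_iff)
qed

lemma is_minimizer_iff: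
  fixes h :: "'a \<Rightarrow> ereal"
  shows "is_minimizer h x \<longleftrightarrow> (\<forall>u. h x \<le> h u)"
  by (auto simp: is_minimizer_def is_arg_min_def not_less)

text \<open>The subgradient \<open>v\<close> gives an affine minorant of \<open>h\<close>. Added to
  the quadratic, it makes the sublevel set through \<open>a\<close> bounded, hence compact, so a
  minimum is attained.\<close>

lemma prox_exists:
  fixes h :: "'a::euclidean_space \<Rightarrow> ereal"
  assumes h: "proper_fun h" "lsc_fun h" and v: "v \<in> subdifferential h a"
  shows "\<exists>w. is_minimizer (\<lambda>w. h w + ereal (1 / 2 * (norm (w - p))\<^sup>2)) w"
proof -
  let ?F = "\<lambda>w. h w + ereal (1 / 2 * (norm (w - p))\<^sup>2)"
  obtain ha where ha: "h a = ereal ha"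
    using h v by (cases "h a") (auto simp: proper_fun_def subdifferential_def edom_def)
  define K where "K = {w. ?F w \<le> ?F a}"
  have closed: "closed {w. ?F w \<le> r}" for r
    using h(2) by (intro lsc_fun_add_continuous_closed continuous_intros)
  \<comment> \<open>The centre \<open>p - v\<close> comes from completing the square in the affine
    minorant plus the quadratic; the sphere passes through \<open>a\<close>.\<close>
  have "K \<subseteq> cball (p - v) (norm (a - p + v))"
  proof
    fix w assume "w \<in> K"
    moreover have "h a + ereal (v \<bullet> (w - a)) \<le> h w"
      using v by (auto simp: subdifferential_def)
    ultimately have "v \<bullet> (w - a) + 1 / 2 * (norm (w - p))\<^sup>2 \<le> 1 / 2 * (norm (a - p))\<^sup>2"
      using ha by (cases "h w") (auto simp: K_def)
    then have "(norm (w - p + v))\<^sup>2 \<le> (norm (a - p + v))\<^sup>2"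
      unfolding power2_norm_eq_inner by (simp add: algebra_simps inner_commute)
    then have "norm (w - p + v) \<le> norm (a - p + v)"
      by (simp add: power2_le_iff_abs_le)
    then show "w \<in> cball (p - v) (norm (a - p + v))"
      by (simp add: dist_norm norm_minus_commute algebra_simps)
  qed
  then have "bounded K" using bounded_cball bounded_subset by blast
  then have "compact K"
    using closed by (simp add: K_def compact_eq_bounded_closed)
  moreover have "a \<in> K" by (simp add: K_def)
  ultimately obtain w where w: "w \<in> K" "\<forall>u\<in>K. ?F w \<le> ?F u"
    using compact_attains_inf_closed_sublevels[of K ?F] closed by blast
  have "?F w \<le> ?F u" for u
  proof (cases "u \<in> K")
    case False
    then have "?F a \<le> ?F u" by (simp add: K_def)
    then show ?thesis using w \<open>a \<in> K\<close> by (meson order_trans)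
  qed (use w in auto)
  then show ?thesis by (auto simp: is_minimizer_iff)
qed

lemma prox_unique:
  fixes h :: "'a::real_inner \<Rightarrow> ereal"
  assumes h: "proper_fun h" "econvex_fun h"
    and w: "is_minimizer (\<lambda>w. h w + ereal (1 / 2 * (norm (w - p))\<^sup>2)) w"
    and w': "is_minimizer (\<lambda>w. h w + ereal (1 / 2 * (norm (w - p))\<^sup>2)) w'"
  shows "w = w'"
proof -
  let ?F = "\<lambda>w. h w + ereal (1 / 2 * (norm (w - p))\<^sup>2)"
  obtain a where a: "h a < \<infinity>" using h(1) by (auto simp: proper_fun_def edom_def)
  have fin: "\<exists>r. h u = ereal r" if "is_minimizer ?F u" for u
  proof -
    have "?F u \<le> ?F a" using that by (auto simp: is_minimizer_iff)
    then show ?thesis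
        using a h(1) by (cases "h u"; cases "h a") (auto simp: proper_fun_def)
  qed
  obtain r r' where r: "h w = ereal r" "h w' = ereal r'" using fin w w' by blast
  define u where "u = (1/2) *\<^sub>R w + (1/2) *\<^sub>R w'"
  have "h ((1/2) *\<^sub>R w + (1 - 1/2) *\<^sub>R w') \<le> ereal (1/2) * h w + ereal (1 - 1/2) * h w'"
    using h(2)[unfolded econvex_fun_def, THEN spec, THEN spec, THEN bspec, of "1/2" w w'] by simp
  then have "h u \<le> ereal (r / 2 + r' / 2)" by (simp add: u_def r)
  moreover have "?F w \<le> ?F u" "?F w' \<le> ?F u"
    using w w' by (auto simp: is_minimizer_iff)
  ultimately have "1 / 2 * (norm (w - p))\<^sup>2 + 1 / 2 * (norm (w' - p))\<^sup>2 \<le> (norm (u - p))\<^sup>2"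
    using r h(1) by (cases "h u") (auto simp: proper_fun_def)
  \<comment> \<open>The parallelogram identity: at the midpoint the quadratic gains a multiple of
    the squared distance, which forces the two minimizers to agree.\<close>
  moreover have "(norm (u - p))\<^sup>2 + (norm (w - w'))\<^sup>2 / 4
      = 1 / 2 * (norm (w - p))\<^sup>2 + 1 / 2 * (norm (w' - p))\<^sup>2"
    unfolding power2_norm_eq_inner u_def
    by (simp add: algebra_simps inner_commute add_divide_distrib diff_divide_distrib)
  ultimately have "(norm (w - w'))\<^sup>2 \<le> 0" by linarith
  then show ?thesis by simp
qed

text \<open>Existence and uniqueness together make the definite description in \<open>prox\<close>
  meaningful.\<close>

lemma prox_is_minimizer:
  fixes h :: "'a::euclidean_space \<Rightarrow> ereal"
  assumes "proper_fun h" "lsc_fun h" "econvex_fun h" "v \<in> subdifferential h a"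
  shows "is_minimizer (\<lambda>w. h w + ereal (1 / 2 * (norm (w - p))\<^sup>2)) (prox h p)"
proof -
  obtain w where w: "is_minimizer (\<lambda>w. h w + ereal (1 / 2 * (norm (w - p))\<^sup>2)) w"
    using prox_exists[OF assms(1,2,4)] by blast
  show ?thesis
    unfolding prox_def
  proof (rule theI[where P = "is_minimizer (\<lambda>w. h w + ereal (1 / 2 * (norm (w - p))\<^sup>2))"])
    show "is_minimizer (\<lambda>w. h w + ereal (1 / 2 * (norm (w - p))\<^sup>2)) w" by (rule w)
  qed (rule prox_unique[OF assms(1,3) _ w])
qed

lemma proper_fun_cmult:
  assumes "proper_fun g" "0 < \<mu>"
  shows "proper_fun (\<lambda>w. ereal \<mu> * g w)"
proof -
  have "ereal \<mu> * g z \<noteq> -\<infinity>" for z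
    using assms by (cases "g z") (simp_all add: proper_fun_def)
  moreover obtain z where "g z < \<infinity>"
    using assms(1) by (auto simp: proper_fun_def edom_def)
  then have "ereal \<mu> * g z < \<infinity>"
    using assms(2) by (cases "g z") simp_all
  ultimately show ?thesis unfolding proper_fun_def edom_def by blast
qed

text \<open>In a perfect space the filter \<open>at z\<close> is nontrivial, so that the factor can
  be moved through \<open>Liminf\<close>.\<close>

lemma lsc_fun_cmult:
  fixes g :: "'a::perfect_space \<Rightarrow> ereal"
  assumes "lsc_fun g" "0 < \<mu>"
  shows "lsc_fun (\<lambda>w. ereal \<mu> * g w)"
  using assms unfolding lsc_fun_def
  by (simp add: Liminf_ereal_mult_left ereal_mult_left_mono)

lemma econvex_fun_cmult:
  assumes "econvex_fun g" "0 < \<mu>"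
  shows "econvex_fun (\<lambda>w. ereal \<mu> * g w)"
  unfolding econvex_fun_def
proof (intro allI ballI)
  fix z w and t :: real assume t: "t \<in> {0<..<1}"
  have "ereal \<mu> * g (t *\<^sub>R z + (1 - t) *\<^sub>R w) \<le> ereal \<mu> * (ereal t * g z + ereal (1 - t) * g w)"
    using assms t by (intro ereal_mult_left_mono) (auto simp: econvex_fun_def)
  also have "\<dots> = ereal t * (ereal \<mu> * g z) + ereal (1 - t) * (ereal \<mu> * g w)"
    using t \<open>0 < \<mu>\<close> by (cases "g z"; cases "g w") (simp_all add: algebra_simps)
  finally show "ereal \<mu> * g (t *\<^sub>R z + (1 - t) *\<^sub>R w)
      \<le> ereal t * (ereal \<mu> * g z) + ereal (1 - t) * (ereal \<mu> * g w)" .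
qed

lemma subdifferential_cmult:
  assumes "proper_fun g" "0 < \<mu>" "v \<in> subdifferential g a"
  shows "\<mu> *\<^sub>R v \<in> subdifferential (\<lambda>w. ereal \<mu> * g w) a"
proof -
  obtain r where r: "g a = ereal r"
    using assms by (cases "g a") (auto simp: proper_fun_def subdifferential_def edom_def)
  have "ereal \<mu> * g a + ereal (\<mu> *\<^sub>R v \<bullet> (w - a)) \<le> ereal \<mu> * g w" for w
  proof -
    have "g a + ereal (v \<bullet> (w - a)) \<le> g w"
      using assms(3) by (auto simp: subdifferential_def)
    then have "ereal \<mu> * (g a + ereal (v \<bullet> (w - a))) \<le> ereal \<mu> * g w"
      using assms(2) by (intro ereal_mult_left_mono) auto
    then show ?thesis by (simp add: r distrib_left)
  qed
  then show ?thesis by (simp add: subdifferential_def edom_def r)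
qed

text \<open>Division by \<mu> turns the problem defining \<open>prox\<close> of the scaled function
  into the one defining the envelope, so both have the minimizer \<open>q\<close>.\<close>

lemma moreau_env_eq_prox:
  fixes g :: "'a::euclidean_space \<Rightarrow> ereal" and p :: 'a
  assumes g: "proper_fun g" "lsc_fun g" "econvex_fun g" "v \<in> subdifferential g a" and "0 < \<mu>"
  defines "q \<equiv> prox (\<lambda>w. ereal \<mu> * g w) p"
  shows "moreau_env \<mu> g p = g q + ereal (1 / (2 * \<mu>) * (norm (q - p))\<^sup>2)"
proof -
  have min: "ereal \<mu> * g q + ereal (1 / 2 * (norm (q - p))\<^sup>2)
      \<le> ereal \<mu> * g w + ereal (1 / 2 * (norm (w - p))\<^sup>2)" for w
    using prox_is_minimizer[OF proper_fun_cmult[OF g(1) \<open>0 < \<mu>\<close>] lsc_fun_cmult[OF g(2) \<open>0 < \<mu>\<close>]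
        econvex_fun_cmult[OF g(3) \<open>0 < \<mu>\<close>] subdifferential_cmult[OF g(1) \<open>0 < \<mu>\<close> g(4)], of p]
    unfolding is_minimizer_iff q_def by blast
  have "g q + ereal (1 / (2 * \<mu>) * (norm (q - p))\<^sup>2)
      \<le> g w + ereal (1 / (2 * \<mu>) * (norm (w - p))\<^sup>2)" for w
  proof (cases "g w")
    case (real r)
    then obtain r' where r': "g q = ereal r'"
      using min[of w] \<open>0 < \<mu>\<close> g(1) by (cases "g q") (simp_all add: proper_fun_def)
    then have "(\<mu> * r' + 1 / 2 * (norm (q - p))\<^sup>2) / \<mu> \<le> (\<mu> * r + 1 / 2 * (norm (w - p))\<^sup>2) / \<mu>"
      using min[of w] \<open>0 < \<mu>\<close> real by (intro divide_right_mono) simp_all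
    then show ?thesis
      using \<open>0 < \<mu>\<close> by (simp add: real r' add_divide_distrib)
  qed (use g(1) in \<open>simp_all add: proper_fun_def\<close>)
  then show ?thesis
    unfolding moreau_env_def by (intro antisym INF_greatest INF_lower) auto
qed

section \<open>Lagrange multipliers of the convex problem\<close>

text \<open>Restriction to the line through \<open>a\<close> and \<open>u\<close> reduces the claim
  to the tangent inequality in one variable, with slope zero at parameter 0 and evaluated at
  parameter 1.\<close>

lemma convex_on_critical_point_min:
  fixes L :: "'a::real_normed_vector \<Rightarrow> real"
  assumes L: "convex_on UNIV L" and deriv: "(L has_derivative (\<lambda>_. 0)) (at a)"
  shows "L a \<le> L u"
proof -
  define p where "p = (\<lambda>t. a + t *\<^sub>R (u - a))"
  have "convex_on UNIV (\<lambda>t. L (p t))"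
  proof (rule convex_onI)
    fix t r r' :: real assume "0 < t" "t < 1"
    moreover have "p ((1 - t) *\<^sub>R r + t *\<^sub>R r') = (1 - t) *\<^sub>R p r + t *\<^sub>R p r'"
      by (simp add: p_def algebra_simps)
    ultimately show "L (p ((1 - t) *\<^sub>R r + t *\<^sub>R r')) \<le> (1 - t) * L (p r) + t * L (p r')"
      using convex_onD[OF L, of t "p r" "p r'"] by simp
  qed simp
  moreover have "((\<lambda>t. L (p t)) has_field_derivative 0) (at 0)"
  proof -
    have "(p has_derivative (\<lambda>t. t *\<^sub>R (u - a))) (at 0)"
      unfolding p_def by (auto intro!: derivative_eq_intros)
    then have "((\<lambda>t. L (p t)) has_derivative (\<lambda>_. 0)) (at 0)"
      using deriv has_derivative_compose[of p _ 0 UNIV L "\<lambda>_. 0"] by (simp add: p_def)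
    then show ?thesis by (simp add: has_field_derivative_def lambda_zero)
  qed
  ultimately have "L (p 1) - L (p 0) \<ge> 0 * (1 - 0)"
    by (intro convex_on_imp_above_tangent[of UNIV "\<lambda>t. L (p t)"]) auto
  then show ?thesis by (simp add: p_def)
qed

text \<open>A step along \<open>d\<close> cannot raise \<open>g\<close>, whereas the subgradient
  inequality predicts a rise of at least the inner product; the finite value \<open>g a\<close>
  cancels.\<close>

lemma subdifferential_hzn_nonpos:
  assumes "proper_fun g" "v \<in> subdifferential g a" "d \<in> hzn g"
  shows "v \<bullet> d \<le> 0"
proof -
  have "g a + ereal (v \<bullet> (a + d - a)) \<le> g (a + d)" "g (a + d) \<le> g a" "a \<in> edom g"
    using assms unfolding subdifferential_def hzn_def by blast+
  then have "g a + ereal (v \<bullet> d) \<le> g a" "g a < \<infinity>"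
    by (auto simp: edom_def)
  then show ?thesis
    using assms(1) by (cases "g a") (auto simp: proper_fun_def)
qed

text \<open>The convexity defect of \<open>c\<close> lies in \<open>hzn g\<close>, and its inner
  product with a subgradient is nonpositive.\<close>

lemma convex_on_multiplier_constraint:
  assumes "proper_fun g" "v \<in> subdifferential g a" "neg_hzn_convex g c"
  shows "convex_on UNIV (\<lambda>x. v \<bullet> c x)"
proof (rule convex_onI)
  fix t :: real and x x' assume "0 < t" "t < 1"
  \<comment> \<open>The parameter is \<open>1 - t\<close>, since \<open>convex_onI\<close> puts the
    weight \<open>t\<close> on the second point and \<open>neg_hzn_convex\<close> on the
    first.\<close>
  then have "c ((1 - t) *\<^sub>R x + (1 - (1 - t)) *\<^sub>R x') - (1 - t) *\<^sub>R c x - (1 - (1 - t)) *\<^sub>R c x' \<in> hzn g"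
    using assms(3) unfolding neg_hzn_convex_def by (metis atLeastAtMost_iff diff_ge_0_iff_ge
        diff_le_eq le_add_same_cancel1 less_imp_le)
  then show "v \<bullet> c ((1 - t) *\<^sub>R x + t *\<^sub>R x') \<le> (1 - t) * (v \<bullet> c x) + t * (v \<bullet> c x')"
    using subdifferential_hzn_nonpos[OF assms(1,2)] by (fastforce simp: inner_diff_right)
qed simp

lemma C1_fun_differentiable: "C1_fun F \<Longrightarrow> F differentiable (at x)"
  unfolding C1_fun_def differentiable_def by blast

text \<open>The definite description in \<open>gradient\<close> is justified by the Riesz
  representative of the derivative, built from its values on the basis, and by uniqueness of
  derivatives.\<close>

lemma GDERIV_gradient:
  fixes f :: "'a::euclidean_space \<Rightarrow> real"
  assumes "f differentiable (at x)"
  shows "GDERIV f x :> gradient f x"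
proof -
  obtain D where D: "(f has_derivative D) (at x)"
    using assms by (auto simp: differentiable_def)
  define d where "d = (\<Sum>b\<in>Basis. D b *\<^sub>R b)"
  have "D h = h \<bullet> d" for h
  proof -
    have "D h = D (\<Sum>b\<in>Basis. (h \<bullet> b) *\<^sub>R b)"
      by (simp only: euclidean_representation)
    also have "\<dots> = (\<Sum>b\<in>Basis. (h \<bullet> b) *\<^sub>R D b)"
      using has_derivative_linear[OF D] by (simp only: linear_sum linear_scale o_def)
    also have "\<dots> = h \<bullet> d"
      unfolding d_def inner_sum_right by (intro sum.cong) auto
    finally show ?thesis .
  qed
  then have "D = (\<lambda>h. h \<bullet> d)" ..
  then have d: "GDERIV f x :> d"
    using D by (simp add: gderiv_def)
  show ?thesis
    unfolding gradient_def
  proof (rule theI[where P = "\<lambda>d. GDERIV f x :> d", OF d])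
    fix d' assume "GDERIV f x :> d'"
    then have "(\<lambda>h. h \<bullet> d') = (\<lambda>h. h \<bullet> d)"
      using d has_derivative_unique unfolding gderiv_def by blast
    then show "d' = d"
      by (metis vector_eq_ldot)
  qed
qed

text \<open>Stationarity says that the convex Lagrangian with fixed multiplier \<open>v\<close> has
  derivative zero at \<open>xs\<close>.\<close>

lemma multiplier_lagrangian_min:
  fixes f :: "real^'n \<Rightarrow> real" and c :: "real^'n \<Rightarrow> real^'m"
  assumes f: "C1_fun f" "convex_on UNIV f" and c: "C1_fun c" "neg_hzn_convex g c"
    and v: "proper_fun g" "v \<in> subdifferential g a"
    and stat: "gradient f xs + transpose (jacobian c (at xs)) *v v = 0"
  shows "f xs + v \<bullet> c xs \<le> f u + v \<bullet> c u"
proof (rule convex_on_critical_point_min[of "\<lambda>x. f x + v \<bullet> c x"])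
  show "convex_on UNIV (\<lambda>x. f x + v \<bullet> c x)"
    using f(2) convex_on_multiplier_constraint[OF v c(2)] by (rule convex_on_add)
  have "(f has_derivative (\<lambda>h. h \<bullet> gradient f xs)) (at xs)"
    using GDERIV_gradient[OF C1_fun_differentiable[OF f(1)]] by (simp add: gderiv_def)
  moreover have "(c has_derivative (\<lambda>h. jacobian c (at xs) *v h)) (at xs)"
    using C1_fun_differentiable[OF c(1)] by (simp add: jacobian_works)
  then have "((\<lambda>x. v \<bullet> c x) has_derivative (\<lambda>h. v \<bullet> (jacobian c (at xs) *v h))) (at xs)"
    by (rule has_derivative_inner_right)
  ultimately have "((\<lambda>x. f x + v \<bullet> c x) has_derivative
      (\<lambda>h. h \<bullet> gradient f xs + v \<bullet> (jacobian c (at xs) *v h))) (at xs)"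
    by (rule has_derivative_add)
  moreover have "h \<bullet> gradient f xs + v \<bullet> (jacobian c (at xs) *v h) = 0" for h
  proof -
    have "v \<bullet> (jacobian c (at xs) *v h) = h \<bullet> (transpose (jacobian c (at xs)) *v v)"
      by (simp add: inner_commute flip: dot_lmul_matrix)
    then have "h \<bullet> gradient f xs + v \<bullet> (jacobian c (at xs) *v h)
        = h \<bullet> (gradient f xs + transpose (jacobian c (at xs)) *v v)"
      by (simp add: inner_add_right)
    then show ?thesis unfolding stat by simp
  qed
  ultimately show "((\<lambda>x. f x + v \<bullet> c x) has_derivative (\<lambda>_. 0)) (at xs)" by simp
qed

text \<open>Minimality of the Lagrangian at \<open>xs\<close> is added to the subgradient inequality
  at \<open>w\<close>. The point \<open>w\<close> stays free so that it can later be the proximal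
  point instead of \<open>c u\<close>.\<close>

lemma objective_le_perturbed_value:
  assumes min: "\<And>u. f xs + v \<bullet> c xs \<le> f u + v \<bullet> c u"
    and v: "v \<in> subdifferential g (c xs)"
  shows "objective f g c xs \<le> ereal (f u) + g w + ereal (v \<bullet> (c u - w))"
proof -
  have "g (c xs) + ereal (v \<bullet> (w - c xs)) \<le> g w"
    using v by (simp add: subdifferential_def)
  moreover have "f xs \<le> f u + v \<bullet> (w - c xs) + v \<bullet> (c u - w)"
    using min[of u] by (simp add: inner_diff_right)
  ultimately show ?thesis
    unfolding objective_def by (cases "g (c xs)"; cases "g w") auto
qed

section \<open>The augmented Lagrangian method\<close>

text \<open>Testing the envelope at \<open>c u\<close> produces exactly the quadratic in
  \<open>y\<close> that the augmented Lagrangian subtracts.\<close>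

lemma aug_lagrangian_le_objective:
  assumes "0 < \<mu>"
  shows "aug_lagrangian f g c \<mu> u y \<le> objective f g c u"
proof -
  have "moreau_env \<mu> g (c u + \<mu> *\<^sub>R y)
      \<le> g (c u) + ereal (1 / (2 * \<mu>) * (norm (c u - (c u + \<mu> *\<^sub>R y)))\<^sup>2)"
    unfolding moreau_env_def by (rule INF_lower) simp
  also have "1 / (2 * \<mu>) * (norm (c u - (c u + \<mu> *\<^sub>R y)))\<^sup>2 = \<mu> / 2 * (norm y)\<^sup>2"
    using assms by (simp add: power_mult_distrib power2_eq_square field_simps)
  finally show ?thesis
    unfolding aug_lagrangian_def objective_def
    by (cases "moreau_env \<mu> g (c u + \<mu> *\<^sub>R y)"; cases "g (c u)") auto
qed

text \<open>With the envelope evaluated at its proximal point, expanding the square cancels the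
  quadratic in \<open>y\<close> and leaves a linear multiplier term plus a penalty on the
  residual.\<close>

lemma aug_lagrangian_eq_prox:
  fixes g :: "'b::euclidean_space \<Rightarrow> ereal"
  assumes g: "proper_fun g" "lsc_fun g" "econvex_fun g" "v \<in> subdifferential g a" and "0 < \<mu>"
    and q: "q = prox (\<lambda>w. ereal \<mu> * g w) (c u + \<mu> *\<^sub>R y)"
  shows "aug_lagrangian f g c \<mu> u y
    = ereal (f u) + g q + ereal (y \<bullet> (c u - q) + (norm (c u - q))\<^sup>2 / (2 * \<mu>))"
proof -
  have "(norm (q - (c u + \<mu> *\<^sub>R y)))\<^sup>2
      = (norm (c u - q))\<^sup>2 + 2 * \<mu> * (y \<bullet> (c u - q)) + \<mu>\<^sup>2 * (norm y)\<^sup>2"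
    unfolding power2_norm_eq_inner
    by (simp add: algebra_simps inner_commute power2_eq_square)
  then have "1 / (2 * \<mu>) * (norm (q - (c u + \<mu> *\<^sub>R y)))\<^sup>2 - \<mu> / 2 * (norm y)\<^sup>2
      = y \<bullet> (c u - q) + (norm (c u - q))\<^sup>2 / (2 * \<mu>)"
    using \<open>0 < \<mu>\<close> by (simp add: field_simps power2_eq_square)
  then show ?thesis
    unfolding aug_lagrangian_def moreau_env_eq_prox[OF g \<open>0 < \<mu>\<close>] q[symmetric]
    by (cases "g q") auto
qed

text \<open>The scalar core of the convergence proof. The positive, decreasing penalties have a
  limit \<open>l\<close>; the quadratic bound settles \<open>l = 0\<close> and the update test
  settles the other case.\<close>

lemma penalty_residual_tendsto_zero:
  fixes \<mu> \<epsilon> \<sigma> :: "nat \<Rightarrow> real"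
  assumes "0 < \<mu> 0" and \<beta>: "\<beta> \<in> {0<..<1}" and \<theta>: "\<theta> \<in> {0<..<1}"
    and update: "\<And>k. \<mu> (Suc k) = (if k = 0 \<or> \<sigma> k \<le> \<theta> * \<sigma> (k - 1) then \<mu> k else \<beta> * \<mu> k)"
    and \<sigma>: "\<And>k. 0 \<le> \<sigma> k" "\<And>k. (\<sigma> k)\<^sup>2 \<le> 2 * \<mu> k * (\<epsilon> k + C * \<sigma> k)"
    and \<epsilon>: "(\<lambda>k. \<epsilon> k / \<mu> k) \<longlonglongrightarrow> 0"
  shows "\<sigma> \<longlonglongrightarrow> 0"
proof -
  have \<mu>_pos: "0 < \<mu> k" for k
    by (induction k) (use assms in auto)
  have "\<mu> (Suc k) \<le> \<mu> k" for k
    using update[of k] \<mu>_pos[of k] \<beta> by (auto simp: mult_le_cancel_right1)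
  then have "decseq \<mu>" by (rule decseq_SucI)
  then obtain l where l: "\<mu> \<longlonglongrightarrow> l"
    using \<mu>_pos decseq_convergent[of \<mu> 0] less_imp_le by metis
  show ?thesis
  proof (cases "l = 0")
    case True
    have "\<sigma> k \<le> \<mu> k * C + sqrt (2 * (\<mu> k)\<^sup>2 * (\<epsilon> k / \<mu> k) + (\<mu> k * C)\<^sup>2)" for k
    proof -
      \<comment> \<open>Completing the square solves the quadratic inequality for \<sigma>; the next
        rewriting brings in the ratio \<epsilon>/\<mu>, whose limit is known.\<close>
      have "(\<sigma> k - \<mu> k * C)\<^sup>2 \<le> 2 * \<mu> k * \<epsilon> k + (\<mu> k * C)\<^sup>2"
        using \<sigma>(2)[of k] by (simp add: power2_eq_square algebra_simps)
      also have "\<dots> = 2 * (\<mu> k)\<^sup>2 * (\<epsilon> k / \<mu> k) + (\<mu> k * C)\<^sup>2"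
        using \<mu>_pos[of k] by (simp add: power2_eq_square)
      finally show ?thesis using real_le_rsqrt by fastforce
    qed
    moreover have "(\<lambda>k. \<mu> k * C + sqrt (2 * (\<mu> k)\<^sup>2 * (\<epsilon> k / \<mu> k) + (\<mu> k * C)\<^sup>2))
        \<longlonglongrightarrow> 0 * C + sqrt (2 * 0\<^sup>2 * 0 + (0 * C)\<^sup>2)"
      using l True \<epsilon> by (intro tendsto_intros) auto
    then have lim: "(\<lambda>k. \<mu> k * C + sqrt (2 * (\<mu> k)\<^sup>2 * (\<epsilon> k / \<mu> k) + (\<mu> k * C)\<^sup>2)) \<longlonglongrightarrow> 0"
      by simp
    ultimately show ?thesis
      using \<sigma>(1)
      by (intro tendsto_sandwich[OF always_eventually always_eventually tendsto_const lim]) auto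
  next
    case False
    \<comment> \<open>Successive ratios tend to 1, but a reduction makes the ratio equal to \<beta>,
      which is below 1. Hence reductions eventually stop.\<close>
    have "(\<lambda>k. \<mu> (Suc k) / \<mu> k) \<longlonglongrightarrow> l / l"
      using l False by (intro tendsto_divide LIMSEQ_Suc)
    then have "\<forall>\<^sub>F k in sequentially. \<beta> < \<mu> (Suc k) / \<mu> k"
      using False \<beta> by (intro order_tendstoD) auto
    then obtain N where N: "\<And>k. N \<le> k \<Longrightarrow> \<beta> < \<mu> (Suc k) / \<mu> k"
      by (auto simp: eventually_sequentially)
    \<comment> \<open>The rule is read at \<open>Suc k\<close>, where the exception for index 0 does
      not apply, so an unreduced penalty means that the decrease test succeeded.\<close>
    have step: "\<sigma> (Suc k) \<le> \<theta> * \<sigma> k" if "N \<le> k" for k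
      using N[of "Suc k"] that update[of "Suc k"] \<mu>_pos[of "Suc k"] by (auto split: if_splits)
    have "\<sigma> (n + N) \<le> \<theta> ^ n * \<sigma> N" for n
    proof (induction n)
      case (Suc n)
      have "\<sigma> (Suc n + N) \<le> \<theta> * \<sigma> (n + N)" using step by simp
      also have "\<dots> \<le> \<theta> * (\<theta> ^ n * \<sigma> N)" using Suc \<theta> by (intro mult_left_mono) auto
      finally show ?case by (simp add: mult.assoc)
    qed simp
    moreover have lim: "(\<lambda>n. \<theta> ^ n * \<sigma> N) \<longlonglongrightarrow> 0"
      using \<theta> by (intro tendsto_mult_left_zero LIMSEQ_power_zero) auto
    ultimately have "(\<lambda>n. \<sigma> (n + N)) \<longlonglongrightarrow> 0"
      using \<sigma>(1)
      by (intro tendsto_sandwich[OF always_eventually always_eventually tendsto_const lim]) auto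
    then show ?thesis by (rule LIMSEQ_offset)
  qed
qed

theorem corollary5p7:
  fixes f :: "real^'n \<Rightarrow> real"
    and g :: "real^'m \<Rightarrow> ereal"
    and c :: "real^'n \<Rightarrow> real^'m"
    and S :: "(real^'m) set"
    and \<mu> \<epsilon> :: "nat \<Rightarrow> real"
    and x :: "nat \<Rightarrow> real^'n"
    and z y yhat :: "nat \<Rightarrow> real^'m"
  assumes "standing_assumption f g c"
    and "\<exists>xs. is_minimizer (objective f g c) xs \<and> stationary f g c xs"
    and "safeguarded_ALM f g c S \<mu> \<epsilon> x z y yhat"
    and "summable (\<lambda>k. sqrt (\<epsilon> k / \<mu> k))"
    and "\<exists>\<beta>\<in>{0<..<1}. \<exists>\<theta>\<in>{0<..<1}. penalty_update \<beta> \<theta> c x z \<mu>"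
  shows "(\<lambda>k. c (x k) - z k) \<longlonglongrightarrow> 0
    \<and> limsup (\<lambda>k. ereal (f (x k)) + g (z k)) \<le> min_value f g c
    \<and> (\<forall>xbar. seq_accumulation_point x xbar \<longrightarrow> is_minimizer (objective f g c) xbar)
    \<and> (\<forall>r xbar. strict_mono r \<and> (\<lambda>k. x (r k)) \<longlonglongrightarrow> xbar \<longrightarrow>
          (\<lambda>k. z (r k)) \<longlonglongrightarrow> c xbar
        \<and> (\<lambda>k. ereal (f (x (r k))) + g (z (r k))) \<longlonglongrightarrow> min_value f g c)"
proof -
  have f: "C1_fun f" "convex_on UNIV f" and c: "C1_fun c" "neg_hzn_convex g c"
    and g: "proper_fun g" "lsc_fun g" "econvex_fun g"
    using assms(1) by (simp_all add: standing_assumption_def)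
  obtain xs v where xs: "is_minimizer (objective f g c) xs"
    and v: "v \<in> subdifferential g (c xs)"
    and stat: "gradient f xs + transpose (jacobian c (at xs)) *v v = 0"
    using assms(2) by (auto simp: stationary_def)
  obtain \<beta> \<theta> where \<beta>\<theta>: "\<beta> \<in> {0<..<1}" "\<theta> \<in> {0<..<1}"
    and update: "penalty_update \<beta> \<theta> c x z \<mu>"
    using assms(5) by blast
  have S: "S \<noteq> {}" "compact S" and \<mu>0: "0 < \<mu> 0"
    and yhat: "yhat k = closest_point S (y k)" and \<epsilon>_nonneg: "0 \<le> \<epsilon> k"
    and x_approx: "aug_lagrangian f g c (\<mu> k) (x k) (yhat k)
        \<le> (INF u. aug_lagrangian f g c (\<mu> k) u (yhat k)) + ereal (\<epsilon> k)"
    and z_prox: "z k = prox (\<lambda>w. ereal (\<mu> k) * g w) (c (x k) + \<mu> k *\<^sub>R yhat k)" for k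
    using assms(3) unfolding safeguarded_ALM_def by blast+
  define s where "s = (\<lambda>k. c (x k) - z k)"
  have \<mu>_Suc: "\<mu> (Suc k) = (if k = 0 \<or> norm (s k) \<le> \<theta> * norm (s (k - 1)) then \<mu> k else \<beta> * \<mu> k)" for k
    using update by (simp add: penalty_update_def s_def)
  have \<mu>_pos: "0 < \<mu> k" for k
    by (induction k) (use \<mu>0 \<beta>\<theta> in \<open>auto simp: \<mu>_Suc\<close>)
  have \<mu>_le: "\<mu> k \<le> \<mu> 0" for k
  proof (induction k)
    case (Suc k)
    have "\<mu> (Suc k) \<le> \<mu> k"
      using \<mu>_pos[of k] \<beta>\<theta> by (simp add: \<mu>_Suc mult_le_cancel_right1)
    then show ?case using Suc by simp
  qed simp

  have inf_eq: "min_value f g c = objective f g c xs"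
    using xs unfolding min_value_def is_minimizer_iff
    by (intro antisym INF_lower INF_greatest) auto
  \<comment> \<open>The minimal value is finite because a point with a subgradient lies in
    \<open>edom g\<close>.\<close>
  obtain \<Phi> where \<Phi>: "min_value f g c = ereal \<Phi>"
    using g(1) v inf_eq
    by (cases "g (c xs)") (auto simp: objective_def proper_fun_def subdifferential_def edom_def)

  have upper: "ereal (f (x k)) + g (z k) + ereal (yhat k \<bullet> s k + (norm (s k))\<^sup>2 / (2 * \<mu> k))
      \<le> ereal (\<Phi> + \<epsilon> k)" for k
  proof -
    have "ereal (f (x k)) + g (z k) + ereal (yhat k \<bullet> s k + (norm (s k))\<^sup>2 / (2 * \<mu> k))
        = aug_lagrangian f g c (\<mu> k) (x k) (yhat k)"
      unfolding s_def by (rule aug_lagrangian_eq_prox[OF g v \<mu>_pos, symmetric]) (rule z_prox)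
    also have "\<dots> \<le> (INF u. aug_lagrangian f g c (\<mu> k) u (yhat k)) + ereal (\<epsilon> k)"
      by (rule x_approx)
    \<comment> \<open>The infimum is tested at the minimizer \<open>xs\<close>.\<close>
    also have "(INF u. aug_lagrangian f g c (\<mu> k) u (yhat k)) \<le> ereal \<Phi>"
      unfolding \<Phi>[symmetric] inf_eq
      by (rule INF_lower2[OF UNIV_I]) (rule aug_lagrangian_le_objective[OF \<mu>_pos])
    finally show ?thesis by (simp add: add_right_mono)
  qed
  \<comment> \<open>The finite upper bound excludes the value infinity, so the remaining estimates
    can be made over the reals with \<open>G\<close>.\<close>
  have "\<exists>r. g (z k) = ereal r" for k
    using upper[of k] g(1) by (cases "g (z k)") (auto simp: proper_fun_def)
  then obtain G where G: "\<And>k. g (z k) = ereal (G k)" by metis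
  have upper_real: "f (x k) + G k + yhat k \<bullet> s k + (norm (s k))\<^sup>2 / (2 * \<mu> k) \<le> \<Phi> + \<epsilon> k" for k
    using upper[of k] by (simp add: G add.assoc)
  have lower: "\<Phi> - v \<bullet> s k \<le> f (x k) + G k" for k
  proof -
    have "ereal \<Phi> \<le> ereal (f (x k)) + g (z k) + ereal (v \<bullet> (c (x k) - z k))"
      unfolding \<Phi>[symmetric] inf_eq
      by (rule objective_le_perturbed_value) (rule multiplier_lagrangian_min[OF f c g(1) v stat], rule v)
    then show ?thesis by (simp add: G s_def)
  qed

  have \<epsilon>\<mu>: "(\<lambda>k. \<epsilon> k / \<mu> k) \<longlonglongrightarrow> 0"
  proof -
    \<comment> \<open>The terms of a summable series vanish, and squaring removes the root.\<close>
    have "(\<lambda>k. (sqrt (\<epsilon> k / \<mu> k))\<^sup>2) \<longlonglongrightarrow> 0\<^sup>2"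
      by (intro tendsto_power summable_LIMSEQ_zero assms(4))
    then show ?thesis using \<epsilon>_nonneg \<mu>_pos by (simp add: less_imp_le)
  qed
  have \<epsilon>: "\<epsilon> \<longlonglongrightarrow> 0"
  proof -
    have "\<epsilon> k \<le> \<mu> 0 * (\<epsilon> k / \<mu> k)" for k
      using \<mu>_le[of k] \<mu>_pos[of k] \<epsilon>_nonneg[of k] by (simp add: pos_le_divide_eq mult_left_mono mult.commute)
    moreover have lim: "(\<lambda>k. \<mu> 0 * (\<epsilon> k / \<mu> k)) \<longlonglongrightarrow> 0"
      using tendsto_mult_left[OF \<epsilon>\<mu>, of "\<mu> 0"] by simp
    ultimately show ?thesis
      using \<epsilon>_nonneg
      by (intro tendsto_sandwich[OF always_eventually always_eventually tendsto_const lim]) auto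
  qed

  have yhat_in: "yhat k \<in> S" for k
    using S by (simp add: yhat closest_point_in_set compact_imp_closed)
  \<comment> \<open>The safeguard enters here: projection onto the compact set \<open>S\<close>
    bounds all multiplier estimates uniformly.\<close>
  obtain B where B: "\<And>k. norm (yhat k) \<le> B"
    using S yhat_in compact_imp_bounded bounded_iff by metis
  \<comment> \<open>Subtracting \<open>lower\<close> from \<open>upper_real\<close> eliminates the
    objective values; Cauchy-Schwarz bounds the remaining pairing of \<open>v - yhat k\<close> with
    the residual.\<close>
  have residual: "(norm (s k))\<^sup>2 \<le> 2 * \<mu> k * (\<epsilon> k + (norm v + B) * norm (s k))" for k
  proof -
    have "(v - yhat k) \<bullet> s k \<le> (norm v + B) * norm (s k)"
      using norm_triangle_ineq4[of v "yhat k"] B[of k]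
      by (intro order_trans[OF norm_cauchy_schwarz] mult_right_mono) auto
    then have "(norm (s k))\<^sup>2 / (2 * \<mu> k) \<le> \<epsilon> k + (norm v + B) * norm (s k)"
      using lower[of k] upper_real[of k] by (simp add: inner_diff_left)
    then show ?thesis
      using \<mu>_pos[of k] by (simp add: pos_divide_le_eq mult.commute)
  qed
  have "(\<lambda>k. norm (s k)) \<longlonglongrightarrow> 0"
    by (rule penalty_residual_tendsto_zero[OF \<mu>_pos \<beta>\<theta> \<mu>_Suc norm_ge_zero residual \<epsilon>\<mu>])
  then have s: "s \<longlonglongrightarrow> 0" by (rule tendsto_norm_zero_cancel)

  have objective_real_lim: "(\<lambda>k. f (x k) + G k) \<longlonglongrightarrow> \<Phi>"
  proof (rule tendsto_sandwich[OF always_eventually always_eventually])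
    show "\<forall>k. \<Phi> - v \<bullet> s k \<le> f (x k) + G k" using lower by blast
    show "\<forall>k. f (x k) + G k \<le> \<Phi> + \<epsilon> k + B * norm (s k)"
    proof
      fix k
      have "- (yhat k \<bullet> s k) \<le> B * norm (s k)"
        using norm_cauchy_schwarz[of "- yhat k" "s k"] B[of k]
          mult_right_mono[of "norm (yhat k)" B "norm (s k)"] by simp
      \<comment> \<open>The penalty term is dropped by its sign, so its size for small \<mu> does
        not matter.\<close>
      moreover have "0 \<le> (norm (s k))\<^sup>2 / (2 * \<mu> k)" using \<mu>_pos[of k] by simp
      ultimately show "f (x k) + G k \<le> \<Phi> + \<epsilon> k + B * norm (s k)"
        using upper_real[of k] by linarith
    qed
    have "(\<lambda>k. \<Phi> - v \<bullet> s k) \<longlonglongrightarrow> \<Phi> - v \<bullet> 0"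
      using s by (intro tendsto_intros)
    then show "(\<lambda>k. \<Phi> - v \<bullet> s k) \<longlonglongrightarrow> \<Phi>" by simp
    have "(\<lambda>k. \<Phi> + \<epsilon> k + B * norm (s k)) \<longlonglongrightarrow> \<Phi> + 0 + B * norm (0 :: real^'m)"
      using s \<epsilon> by (intro tendsto_intros)
    then show "(\<lambda>k. \<Phi> + \<epsilon> k + B * norm (s k)) \<longlonglongrightarrow> \<Phi>" by simp
  qed
  \<comment> \<open>The values converge along the whole sequence, which yields both the
    \<open>limsup\<close> bound and the limits along subsequences.\<close>
  then have objective_lim: "(\<lambda>k. ereal (f (x k)) + g (z k)) \<longlonglongrightarrow> min_value f g c"
    by (simp add: G \<Phi>)

  have z_lim: "(\<lambda>k. z (r k)) \<longlonglongrightarrow> c xbar"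
    if r: "strict_mono r" "(\<lambda>k. x (r k)) \<longlonglongrightarrow> xbar" for r :: "nat \<Rightarrow> nat" and xbar
  proof -
    have "isCont c xbar"
      using C1_fun_differentiable[OF c(1)] by (rule differentiable_imp_continuous_within)
    then have "(\<lambda>k. c (x (r k))) \<longlonglongrightarrow> c xbar" using r(2) by (rule isCont_tendsto_compose)
    moreover have "(\<lambda>k. s (r k)) \<longlonglongrightarrow> 0"
      using LIMSEQ_subseq_LIMSEQ[OF s r(1)] by (simp add: o_def)
    ultimately have "(\<lambda>k. c (x (r k)) - s (r k)) \<longlonglongrightarrow> c xbar - 0" by (rule tendsto_diff)
    then show ?thesis by (simp add: s_def)
  qed
  have objective_lim_sub: "(\<lambda>k. ereal (f (x (r k))) + g (z (r k))) \<longlonglongrightarrow> min_value f g c"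
    if "strict_mono r" for r :: "nat \<Rightarrow> nat"
    using LIMSEQ_subseq_LIMSEQ[OF objective_lim that] by (simp add: o_def)
  have minimizer: "is_minimizer (objective f g c) xbar"
    if r: "strict_mono r" "(\<lambda>k. x (r k)) \<longlonglongrightarrow> xbar" for r :: "nat \<Rightarrow> nat" and xbar
  proof -
    have "isCont f xbar"
      using C1_fun_differentiable[OF f(1)] by (rule differentiable_imp_continuous_within)
    then have "(\<lambda>k. f (x (r k))) \<longlonglongrightarrow> f xbar" using r(2) by (rule isCont_tendsto_compose)
    then have "liminf (\<lambda>k. ereal (f (x (r k))) + g (z (r k)))
        = ereal (f xbar) + liminf (\<lambda>k. g (z (r k)))"
      by (intro ereal_liminf_lim_add) auto
    moreover have "liminf (\<lambda>k. ereal (f (x (r k))) + g (z (r k))) = min_value f g c"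
      by (intro lim_imp_Liminf objective_lim_sub r) simp
    \<comment> \<open>Lower semicontinuity is applied along \<open>z\<close>, where \<open>g\<close>
      is finite and which has the same limit as \<open>c (x (r k))\<close>.\<close>
    moreover have "g (c xbar) \<le> liminf (\<lambda>k. g (z (r k)))"
      by (rule lsc_funD_liminf[OF g(2) z_lim[OF r]])
    ultimately have "objective f g c xbar \<le> min_value f g c"
      by (simp add: objective_def add_left_mono)
    then show ?thesis
      by (simp add: is_minimizer_iff min_value_def le_INF_iff)
  qed
  have "limsup (\<lambda>k. ereal (f (x k)) + g (z k)) \<le> min_value f g c"
    using lim_imp_Limsup[OF _ objective_lim] by simp
  then show ?thesis
    using s z_lim objective_lim_sub minimizer unfolding seq_accumulation_point_def s_def by blast
qed

end
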